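(* Let $(X,d)$ be a complete metric space, let $C\subseteq X$ be nonempty and closed, and let $T\colon C\to C$. Let $\omega(\cdot;\theta)$ be a contractive gauge, let $R>0$, and let $x_0\in C$ satisfy $C\subseteq\{y\in X: d(x_0,y)\le R\}$. Assume that $T$ is either a two-point gauge contraction on $C$ or a Proinov-type gauge contraction on $C$, with gauge $\omega(\cdot;\theta)$, and that $$\kappa:=\sup_{0<r\le R}\frac{\omega(r;\theta)}{r}<1 .$$ Let $x_{n+1}:=Tx_n$ for $n\in\mathbb N$ and let $x^\ast$ be the unique fixed point of $T$ in $C$. Then $$d(x_n,x^\ast)\le\frac{1}{1-\kappa}\,d(x_n,Tx_n)\qquad(n\in\mathbb N).$$
   Context: $\mathbb N=\{0,1,2,\dots\}$. A contractive gauge is a map $\omega(\cdot;\theta)\colon[0,\infty)\to[0,\infty)$, depending on a finite parameter vector $\theta$, such that $\omega(0;\theta)=0$, $\omega(\cdot;\theta)$ is nondecreasing, and $\omega(r;\theta)<r$ for every $r>0$. $T\colon C\to C$ is a two-point gauge contraction on $C$ with gauge $\omega(\cdot;\theta)$ if $d(Tx,Ty)\le\omega(d(x,y);\theta)$ for all $x,y\in C$. $T\colon C\to C$ is a Proinov-type gauge contraction on $C$ with gauge $\omega(\cdot;\theta)$ if $d(Tx,Ty)\le\omega(M_T(x,y);\theta)$ for all $x,y\in C$, where $$M_T(x,y):=\max\Bigl\{d(x,y),\ d(x,Tx),\ d(y,Ty),\ \tfrac12\bigl(d(x,Ty)+d(y,Tx)\bigr)\Bigr\}.$$ Under the hypotheses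 of the claim, $T$ has exactly one fixed point in $C$. *)

theory Defs
  imports "HOL-Analysis.Analysis"
begin

text \<open>
  A gauge is defined on the nonnegative reals only: values of \<open>g\<close> at negative
  arguments are irrelevant and left unconstrained.  For a family \<open>\<omega>(\<cdot>; \<theta>)\<close> these predicates are
  applied to the partial application \<open>\<omega> \<theta>\<close>.
\<close>

definition contractive_gauge :: "(real \<Rightarrow> real) \<Rightarrow> bool" where
  "contractive_gauge g \<longleftrightarrow>
     g \<in> {0..} \<rightarrow> {0..} \<and> g 0 = 0 \<and> mono_on {0..} g \<and> (\<forall>r>0. g r < r)"

definition two_point_gauge_contraction ::
  "'a::metric_space set \<Rightarrow> (real \<Rightarrow> real) \<Rightarrow> ('a \<Rightarrow> 'a) \<Rightarrow> bool" where
  "two_point_gauge_contraction C g T \<longleftrightarrow>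
     (\<forall>x\<in>C. \<forall>y\<in>C. dist (T x) (T y) \<le> g (dist x y))"

definition proinov_M :: "('a::metric_space \<Rightarrow> 'a) \<Rightarrow> 'a \<Rightarrow> 'a \<Rightarrow> real" where
  "proinov_M T x y =
     Max {dist x y, dist x (T x), dist y (T y), (dist x (T y) + dist y (T x)) / 2}"

definition proinov_gauge_contraction ::
  "'a::metric_space set \<Rightarrow> (real \<Rightarrow> real) \<Rightarrow> ('a \<Rightarrow> 'a) \<Rightarrow> bool" where
  "proinov_gauge_contraction C g T \<longleftrightarrow>
     (\<forall>x\<in>C. \<forall>y\<in>C. dist (T x) (T y) \<le> g (proinov_M T x y))"

end

theory Submission imports Defs begin

text \<open>
  Monotonicity of the gauge makes every two-point contraction a Proinov-type one. Since
  \<open>M\<^sub>T(y, T y)\<close> is the larger of two consecutive steps, an orbit whose first step is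
  at most \<open>R\<close> (as \<open>C\<close> lies in the ball of radius \<open>R\<close> around \<open>x\<^sub>0\<close>) has
  steps shrinking by the factor \<open>\<kappa>\<close>. Summing the geometric series from index \<open>n\<close> gives
  the bound. Estimating \<open>d(T x\<^sub>n, T x\<^sup>*)\<close> by \<open>\<kappa> d(x\<^sub>n, x\<^sup>*)\<close> directly would not do:
  that distance may exceed \<open>R\<close>, where \<open>\<kappa>\<close> says nothing about the gauge.
\<close>

lemma contractive_gauge_less: "contractive_gauge g \<Longrightarrow> 0 < r \<Longrightarrow> g r < r"
  by (simp add: contractive_gauge_def)

lemma contractive_gauge_mono:
  "contractive_gauge g \<Longrightarrow> 0 \<le> r \<Longrightarrow> r \<le> s \<Longrightarrow> g r \<le> g s"
  by (auto simp: contractive_gauge_def intro: mono_onD)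

lemma contractive_gauge_nonneg: "contractive_gauge g \<Longrightarrow> 0 \<le> r \<Longrightarrow> 0 \<le> g r"
  by (auto simp: contractive_gauge_def Pi_iff)

text \<open>A contractive gauge keeps all quotients \<open>g s / s\<close> below 1, so the supremum
  is a genuine upper bound. The point \<open>r = 0\<close> lies outside the index set; there both
  sides vanish.\<close>

lemma contractive_gauge_le_SUP:
  assumes g: "contractive_gauge g" and r: "0 \<le> r" "r \<le> R"
  shows "g r \<le> (SUP s\<in>{0<..R}. g s / s) * r"
proof (cases "r = 0")
  case True
  then show ?thesis
    using g by (simp add: contractive_gauge_def)
next
  case False
  have "bdd_above ((\<lambda>s. g s / s) ` {0<..R})"
    using contractive_gauge_less[OF g] by (intro bdd_aboveI2[where M = 1]) (simp add: less_imp_le)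
  then have "g r / r \<le> (SUP s\<in>{0<..R}. g s / s)"
    using False r by (intro cSUP_upper) auto
  then show ?thesis
    using False r by (simp add: divide_simps)
qed

lemma two_point_imp_proinov_gauge_contraction:
  assumes "contractive_gauge g" and "two_point_gauge_contraction C g T"
  shows "proinov_gauge_contraction C g T"
  unfolding proinov_gauge_contraction_def
proof (intro ballI)
  fix x y assume "x \<in> C" "y \<in> C"
  then have "dist (T x) (T y) \<le> g (dist x y)"
    using assms(2) by (simp add: two_point_gauge_contraction_def)
  also have "\<dots> \<le> g (proinov_M T x y)"
    by (rule contractive_gauge_mono[OF assms(1)]) (simp_all add: proinov_M_def)
  finally show "dist (T x) (T y) \<le> g (proinov_M T x y)" .
qed

text \<open>One summand of the averaged entry is \<open>dist (T y) (T y) = 0\<close>; the triangle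
  inequality bounds the rest by the mean of the two steps, hence by the larger one.\<close>

lemma proinov_M_step:
  "proinov_M T y (T y) = max (dist y (T y)) (dist (T y) (T (T y)))"
proof -
  have "dist y (T (T y)) \<le> dist y (T y) + dist (T y) (T (T y))"
    by (rule dist_triangle)
  then show ?thesis
    by (simp add: proinov_M_def max_def)
qed

lemma proinov_gauge_contraction_step:
  assumes g: "contractive_gauge g" and T: "proinov_gauge_contraction C g T"
    and y: "y \<in> C" "T y \<in> C"
  shows "dist (T y) (T (T y)) \<le> g (dist y (T y))"
proof -
  have le: "dist (T y) (T (T y)) \<le> g (max (dist y (T y)) (dist (T y) (T (T y))))"
    using T y unfolding proinov_gauge_contraction_def proinov_M_step[symmetric] by blast
  show ?thesis
  proof (cases "dist (T y) (T (T y)) \<le> dist y (T y)")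
    case True
    then show ?thesis
      using le by (simp add: max_absorb1)
  next
    case False
    \<comment> \<open>Were the second step the larger one, the maximum would be that step, positive
      because it exceeds a distance, and it could not be bounded by its own gauge value.\<close>
    then have "dist (T y) (T (T y)) \<le> g (dist (T y) (T (T y)))" "0 < dist (T y) (T (T y))"
      using le zero_le_dist[of y "T y"] by (auto simp only: max_def not_le split: if_splits)
    then show ?thesis
      using contractive_gauge_less[OF g, of "dist (T y) (T (T y))"] by linarith
  qed
qed

text \<open>At two fixed points the displacement entries vanish and the averaged entry is the
  distance itself, so \<open>proinov_M\<close> collapses to \<open>dist y z\<close>.\<close>

lemma proinov_gauge_contraction_fixpoint_unique:
  assumes g: "contractive_gauge g" and T: "proinov_gauge_contraction C g T"
    and "y \<in> C" "T y = y" "z \<in> C" "T z = z"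
  shows "y = z"
proof (rule ccontr)
  assume "y \<noteq> z"
  moreover have "proinov_M T y z = dist y z"
    using assms by (simp add: proinov_M_def dist_commute max_def)
  then have "dist y z \<le> g (dist y z)"
    using assms unfolding proinov_gauge_contraction_def by metis
  ultimately show False
    using contractive_gauge_less[OF g, of "dist y z"] by simp
qed

text \<open>The gauge may be discontinuous, so no limit is taken inside it. If \<open>z\<close> were
  moved by \<delta> > 0, the entries of \<open>proinov_M T (x n) z\<close> other than
  \<open>dist z (T z)\<close> would tend to 0, 0 and \<delta>/2. Eventually the maximum is exactly
  \<delta>, and the limit of the left-hand sides gives \<delta> \<le> \<open>g\<close>
  \<delta>.\<close>

lemma proinov_gauge_contraction_limit_fixpoint:
  assumes g: "contractive_gauge g" and T: "proinov_gauge_contraction C g T"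
    and x: "\<And>n. x n \<in> C" "\<And>n. x (Suc n) = T (x n)"
    and z: "x \<longlonglongrightarrow> z" "z \<in> C"
  shows "T z = z"
proof (rule ccontr)
  assume "T z \<noteq> z"
  define \<delta> where "\<delta> = dist z (T z)"
  have "\<delta> > 0"
    using \<open>T z \<noteq> z\<close> by (simp add: \<delta>_def)
  have z': "(\<lambda>n. T (x n)) \<longlonglongrightarrow> z"
    using LIMSEQ_Suc[OF z(1)] by (simp add: x)
  have "(\<lambda>n. dist (x n) z) \<longlonglongrightarrow> 0" "(\<lambda>n. dist (x n) (T (x n))) \<longlonglongrightarrow> 0"
    using tendsto_dist[OF z(1) tendsto_const, of z] tendsto_dist[OF z(1) z'] by simp_all
  moreover have "(\<lambda>n. (dist (x n) (T z) + dist z (T (x n))) / 2) \<longlonglongrightarrow> \<delta> / 2"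
    unfolding \<delta>_def by (rule tendsto_eq_intros z z' refl | simp)+
  ultimately have "\<forall>\<^sub>F n in sequentially. dist (x n) z < \<delta>"
      "\<forall>\<^sub>F n in sequentially. dist (x n) (T (x n)) < \<delta>"
      "\<forall>\<^sub>F n in sequentially. (dist (x n) (T z) + dist z (T (x n))) / 2 < \<delta>"
    using \<open>\<delta> > 0\<close> order_tendstoD(2)[where a = \<delta>] by force+
  then have "\<forall>\<^sub>F n in sequentially. dist (T (x n)) (T z) \<le> g \<delta>"
  proof eventually_elim
    case (elim n)
    then have "proinov_M T (x n) z = \<delta>"
      by (simp add: proinov_M_def \<delta>_def[symmetric] max_def)
    then show ?case
      using T x(1) z(2) unfolding proinov_gauge_contraction_def by metis
  qed
  moreover have "(\<lambda>n. dist (T (x n)) (T z)) \<longlonglongrightarrow> \<delta>"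
    unfolding \<delta>_def by (intro tendsto_dist z' tendsto_const)
  ultimately have "\<delta> \<le> g \<delta>"
    using tendsto_upperbound by fastforce
  then show False
    using contractive_gauge_less[OF g \<open>\<delta> > 0\<close>] by simp
qed

lemma geometric_steps_dist_le:
  fixes x :: "nat \<Rightarrow> 'a::metric_space"
  assumes step: "\<And>n. dist (x (Suc n)) (x (Suc (Suc n))) \<le> k * dist (x n) (x (Suc n))"
    and k: "0 \<le> k" "k < 1"
  shows "dist (x n) (x (n + m)) \<le> 1 / (1 - k) * dist (x n) (x (Suc n))"
proof -
  \<comment> \<open>Induction on \<open>m\<close> for all \<open>n\<close> at once: the hypothesis
    at \<open>Suc n\<close> bounds the tail by the next step, at most \<open>k\<close> times the
    current one, and (1 - k) + k = 1 closes the sum.\<close>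
  have "(1 - k) * dist (x n) (x (n + m)) \<le> dist (x n) (x (Suc n))" for n
  proof (induction m arbitrary: n)
    case (Suc m)
    have "dist (x n) (x (n + Suc m)) \<le>
        dist (x n) (x (Suc n)) + dist (x (Suc n)) (x (Suc n + m))"
      using dist_triangle by simp
    then have "(1 - k) * dist (x n) (x (n + Suc m)) \<le>
        (1 - k) * dist (x n) (x (Suc n)) + (1 - k) * dist (x (Suc n)) (x (Suc n + m))"
      using k unfolding distrib_left[symmetric] by (intro mult_left_mono) auto
    also have "\<dots> \<le> (1 - k) * dist (x n) (x (Suc n)) + k * dist (x n) (x (Suc n))"
      using Suc.IH[of "Suc n"] step[of n] by linarith
    finally show ?case
      by (simp add: algebra_simps)
  qed simp
  then show ?thesis
    using k by (simp add: pos_le_divide_eq mult.commute)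
qed

lemma geometric_steps_Cauchy:
  fixes x :: "nat \<Rightarrow> 'a::metric_space"
  assumes step: "\<And>n. dist (x (Suc n)) (x (Suc (Suc n))) \<le> k * dist (x n) (x (Suc n))"
    and k: "0 \<le> k" "k < 1"
  shows "Cauchy x"
proof (rule metric_CauchyI)
  fix e :: real assume "e > 0"
  have pow: "dist (x n) (x (Suc n)) \<le> k ^ n * dist (x 0) (x 1)" for n
  proof (induction n)
    case (Suc n)
    then show ?case
      using step[of n] mult_left_mono[OF Suc k(1)] by (simp add: mult.assoc)
  qed simp
  have "(\<lambda>n. 1 / (1 - k) * (k ^ n * dist (x 0) (x 1))) \<longlonglongrightarrow> 1 / (1 - k) * (0 * dist (x 0) (x 1))"
    using k by (intro tendsto_intros LIMSEQ_power_zero) simp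
  then have "\<forall>\<^sub>F n in sequentially. 1 / (1 - k) * (k ^ n * dist (x 0) (x 1)) < e / 2"
    using \<open>e > 0\<close> by (intro order_tendstoD(2)) auto
  then obtain N where N: "1 / (1 - k) * (k ^ N * dist (x 0) (x 1)) < e / 2"
    by (auto simp: eventually_sequentially)
  \<comment> \<open>Half of \<open>e\<close> suffices per point, since two late terms are compared
    through \<open>x N\<close>.\<close>
  have near: "dist (x N) (x n) < e / 2" if "n \<ge> N" for n
  proof -
    have "dist (x N) (x n) \<le> 1 / (1 - k) * dist (x N) (x (Suc N))"
      using geometric_steps_dist_le[of x k N "n - N"] step k that by simp
    also have "\<dots> \<le> 1 / (1 - k) * (k ^ N * dist (x 0) (x 1))"
      using k by (intro mult_left_mono pow) simp
    finally show ?thesis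
      using N by (rule le_less_trans)
  qed
  show "\<exists>M. \<forall>m\<ge>M. \<forall>n\<ge>M. dist (x m) (x n) < e"
    by (intro exI[of _ N] allI impI dist_triangle_half_r[OF near near])
qed

theorem proposition5p8:
  fixes C :: "'a::complete_space set"
    and T :: "'a \<Rightarrow> 'a"
    and \<omega> :: "real list \<Rightarrow> real \<Rightarrow> real"
    and \<theta> :: "real list"
    and R \<kappa> :: real
    and x0 :: 'a
    and x :: "nat \<Rightarrow> 'a"
  assumes "C \<noteq> {}" and "closed C"
    and "T \<in> C \<rightarrow> C"
    and "contractive_gauge (\<omega> \<theta>)"
    and "R > 0"
    and "x0 \<in> C" and "C \<subseteq> cball x0 R"
    and "two_point_gauge_contraction C (\<omega> \<theta>) T \<or> proinov_gauge_contraction C (\<omega> \<theta>) T"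
    and "\<kappa> = (SUP r\<in>{0<..R}. \<omega> \<theta> r / r)" and "\<kappa> < 1"
    and "x 0 = x0" and "\<And>n. x (Suc n) = T (x n)"
  shows "(\<exists>!z. z \<in> C \<and> T z = z) \<and>
    (\<forall>n. dist (x n) (THE z. z \<in> C \<and> T z = z) \<le> 1 / (1 - \<kappa>) * dist (x n) (T (x n)))"
proof -
  let ?g = "\<omega> \<theta>"
  note g = \<open>contractive_gauge ?g\<close>
  have T: "proinov_gauge_contraction C ?g T"
    using assms(8) two_point_imp_proinov_gauge_contraction[OF g] by blast
  have le_\<kappa>: "?g r \<le> \<kappa> * r" if "0 \<le> r" "r \<le> R" for r
    using contractive_gauge_le_SUP[OF g that] by (simp only: assms(9))
  \<comment> \<open>The sign of \<kappa> is read off at \<open>R\<close>, where the gauge is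
    nonnegative and at most \<kappa> \<open>R\<close>.\<close>
  have "0 \<le> \<kappa> * R"
    using le_\<kappa>[of R] contractive_gauge_nonneg[OF g, of R] \<open>R > 0\<close> by simp
  then have \<kappa>: "0 \<le> \<kappa>"
    using \<open>R > 0\<close> by (simp add: zero_le_mult_iff)
  have xC: "x n \<in> C" for n
    by (induction n) (use assms(3,6,11,12) in auto)
  have gstep: "dist (x (Suc n)) (x (Suc (Suc n))) \<le> ?g (dist (x n) (x (Suc n)))" for n
    using proinov_gauge_contraction_step[OF g T, of "x n"] xC[of n] xC[of "Suc n"]
    by (simp add: assms(12))
  \<comment> \<open>The first step is at most \<open>R\<close> because it starts at the centre of
    the ball; later steps cannot grow, as \<kappa> < 1.\<close>
  have stepR: "dist (x n) (x (Suc n)) \<le> R" for n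
  proof (induction n)
    case 0
    show ?case
      using xC[of 1] assms(7,11) by auto
  next
    case (Suc n)
    have "dist (x (Suc n)) (x (Suc (Suc n))) \<le> \<kappa> * dist (x n) (x (Suc n))"
      using gstep[of n] le_\<kappa>[OF _ Suc] by simp
    also have "\<dots> \<le> 1 * dist (x n) (x (Suc n))"
      using \<open>\<kappa> < 1\<close> by (intro mult_right_mono) auto
    finally show ?case
      using Suc by simp
  qed
  have step: "dist (x (Suc n)) (x (Suc (Suc n))) \<le> \<kappa> * dist (x n) (x (Suc n))" for n
    using gstep[of n] le_\<kappa>[OF _ stepR[of n]] by simp
  obtain z where z: "x \<longlonglongrightarrow> z"
    using geometric_steps_Cauchy[of x \<kappa>] step \<kappa> \<open>\<kappa> < 1\<close>
    by (auto simp: Cauchy_convergent_iff convergent_def)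
  have zC: "z \<in> C"
    using closed_sequentially[OF \<open>closed C\<close> _ z] xC by blast
  have Tz: "T z = z"
    using proinov_gauge_contraction_limit_fixpoint[OF g T _ _ z zC] xC assms(12) by blast
  have ex1: "\<exists>!z. z \<in> C \<and> T z = z"
    using zC Tz proinov_gauge_contraction_fixpoint_unique[OF g T] by blast
  then have the: "(THE z. z \<in> C \<and> T z = z) = z"
    using zC Tz by (intro the1_equality) auto
  \<comment> \<open>The bound on \<open>dist (x n) (x (n + m))\<close> is uniform in
    \<open>m\<close>, so it survives letting \<open>m\<close> tend to infinity with \<open>n\<close>
    fixed.\<close>
  have "dist (x n) z \<le> 1 / (1 - \<kappa>) * dist (x n) (T (x n))" for n
  proof (rule LIMSEQ_le_const2)
    show "(\<lambda>m. dist (x n) (x (n + m))) \<longlonglongrightarrow> dist (x n) z"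
      using LIMSEQ_ignore_initial_segment[OF z, of n]
      by (intro tendsto_dist tendsto_const) (simp add: add.commute)
    show "\<exists>N. \<forall>m\<ge>N. dist (x n) (x (n + m)) \<le> 1 / (1 - \<kappa>) * dist (x n) (T (x n))"
      using geometric_steps_dist_le[of x \<kappa> n] step \<kappa> \<open>\<kappa> < 1\<close> by (simp add: assms(12))
  qed
  then show ?thesis
    using ex1 by (simp add: the)
qed

end
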